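(* Let $m\in\mathbf{N}$. Then $S_{4m+2,4}(A,B)$ is cyclically equivalent in $\mathbf{R}\langle A,B\rangle$ to $$(2m+1)\sum_{p=0}^m f_p^*f_p,$$ where $$f_0=\sum_{s=0}^{2m-1}BA^{2m-s-1}BA^s,$$ $$f_p=\sum_{i=p-1}^{p}\ \sum_{s=p}^{2m-i-1}A^iBA^{2m-s-i-1}BA^s\qquad(1\le p\le m-1),$$ $$f_m=A^{m-1}B^2A^m.$$
   Context: $\mathbf{N}$ denotes the positive integers. $\mathbf{R}\langle A,B\rangle$ is the algebra of real polynomials in noncommuting variables $A$ and $B$, endowed with the linear, anti-multiplicative involution $*$ such that $A^*=A$ and $B^*=B$. $S_{4m+2,4}(A,B)$ denotes the sum of all words of length $4m+2$ in $A$ and $B$ having exactly $4$ letters equal to $B$ (and $4m-2$ equal to $A$). Two elements $f,g\in\mathbf{R}\langle A,B\rangle$ are cyclically equivalent if $f-g$ is a finite sum of commutators $[a,b]=ab-ba$ of elements of $\mathbf{R}\langle A,B\rangle$. *)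

theory Defs
  imports Complex_Main "HOL-Library.Poly_Mapping"
begin

text \<open>
  The free algebra on two noncommuting variables is the monoid algebra over the reals of the
  free monoid of words: finitely supported functions from words to reals, with the convolution
  product of \<^theory>\<open>HOL-Library.Poly_Mapping\<close>. Since that product is taken with respect to the
  additive structure of the index type, concatenation of words is written additively. Words
  have a type of their own so that \<^typ>\<open>'a list\<close> itself gets no arithmetic instance.
\<close>

datatype letter = LA | LB

datatype word = Word (letters: "letter list")

instantiation word :: monoid_add
begin

definition zero_word :: word where
  "zero_word = Word []"

definition plus_word :: "word \<Rightarrow> word \<Rightarrow> word" where
  "plus_word u v = Word (letters u @ letters v)"

instance
  by standard (simp_all add: zero_word_def plus_word_def)

end

type_synonym ncpoly = "word \<Rightarrow>\<^sub>0 real"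

definition var :: "letter \<Rightarrow> ncpoly" where
  "var l = Poly_Mapping.single (Word [l]) 1"

abbreviation varA :: ncpoly where "varA \<equiv> var LA"
abbreviation varB :: ncpoly where "varB \<equiv> var LB"

lemma prod_list_var: "prod_list (map var w) = Poly_Mapping.single (Word w) 1"
  by (induction w) (simp_all add: var_def mult_single plus_word_def flip: zero_word_def)

definition rev_word :: "word \<Rightarrow> word" where
  "rev_word w = Word (rev (letters w))"

lemma rev_word_rev_word [simp]: "rev_word (rev_word w) = w"
  by (simp add: rev_word_def)

lemma inj_rev_word: "inj rev_word"
  by (metis injI rev_word_rev_word)

lemma rev_word_zero [simp]: "rev_word 0 = 0"
  by (simp add: rev_word_def zero_word_def)

lemma rev_word_plus: "rev_word (u + v) = rev_word v + rev_word u"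
  by (simp add: rev_word_def plus_word_def)

text \<open>
  The involution: the coefficient of a word in \<open>star f\<close> is the coefficient of the reversed word
  in \<open>f\<close>. The lemmas below confirm that it is the linear, antimultiplicative involution that
  fixes both variables.
\<close>

definition star :: "ncpoly \<Rightarrow> ncpoly" where
  "star f = Poly_Mapping.map_key rev_word f"

lemma lookup_star: "Poly_Mapping.lookup (star f) w = Poly_Mapping.lookup f (rev_word w)"
  by (simp add: star_def map_key.rep_eq inj_rev_word)

lemma star_zero [simp]: "star 0 = 0"
  by (rule poly_mapping_eqI) (simp add: lookup_star)

lemma star_add: "star (f + g) = star f + star g"
  by (rule poly_mapping_eqI) (simp add: lookup_star lookup_add)

lemma star_single: "star (Poly_Mapping.single w c) = Poly_Mapping.single (rev_word w) c"
  by (rule poly_mapping_eqI) (auto simp: lookup_star lookup_single when_def)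

lemma star_var [simp]: "star (var l) = var l"
  by (simp add: var_def star_single rev_word_def)

lemma star_star [simp]: "star (star f) = f"
  by (rule poly_mapping_eqI) (simp add: lookup_star)

lemma ncpoly_induct [case_names zero single add]:
  fixes f :: ncpoly
  assumes "P 0" "\<And>w c. P (Poly_Mapping.single w c)" "\<And>f g. P f \<Longrightarrow> P g \<Longrightarrow> P (f + g)"
  shows "P f"
proof (induction f rule: update_induct)
  case const
  then show ?case using assms(1) by simp
next
  case (update f w c)
  have "Poly_Mapping.update w c f = f + Poly_Mapping.single w c"
    using update(1)
    by (intro poly_mapping_eqI)
      (auto simp: lookup_update lookup_add lookup_single when_def in_keys_iff)
  then show ?case using assms update by simp
qed

lemma star_mult: "star (f * g) = star g * star f"
proof (induction f rule: ncpoly_induct)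
  case (single u a)
  show ?case
    by (induction g rule: ncpoly_induct)
      (simp_all add: mult_single star_single star_add rev_word_plus algebra_simps)
qed (simp_all add: star_add algebra_simps)

lemma star_scale: "star (Poly_Mapping.single 0 c * f) = Poly_Mapping.single 0 c * star f"
proof (induction f rule: ncpoly_induct)
  case (single w a)
  then show ?case by (simp add: mult_single star_single)
qed (simp_all add: star_add algebra_simps)

definition commutator :: "ncpoly \<Rightarrow> ncpoly \<Rightarrow> ncpoly" where
  "commutator a b = a * b - b * a"

definition cyclically_equivalent :: "ncpoly \<Rightarrow> ncpoly \<Rightarrow> bool" where
  "cyclically_equivalent f g \<longleftrightarrow>
     (\<exists>(n::nat) (a :: nat \<Rightarrow> ncpoly) (b :: nat \<Rightarrow> ncpoly).
        f - g = (\<Sum>k<n. commutator (a k) (b k)))"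

definition S :: "nat \<Rightarrow> nat \<Rightarrow> ncpoly" where
  "S n k = (\<Sum>w | length w = n \<and> count_list w LB = k. prod_list (map var w))"

lemma finite_words: "finite {w :: letter list. length w = n \<and> count_list w LB = k}"
proof (rule finite_subset)
  show "{w. length w = n \<and> count_list w LB = k} \<subseteq> {w. set w \<subseteq> {LA, LB} \<and> length w = n}"
    using letter.exhaust by blast
qed (simp add: finite_lists_length_eq)

text \<open>
  The \<open>p\<close>-th polynomial of the sum of squares, meant for \<open>1 \<le> m\<close> and \<open>p \<le> m\<close>; the last branch is then the case
  \<open>p = m\<close>. In this range no subtraction of natural numbers truncates.
\<close>

definition f_poly :: "nat \<Rightarrow> nat \<Rightarrow> ncpoly" where
  "f_poly m p =
     (if p = 0 then
        (\<Sum>s = 0..2*m - 1. varB * varA ^ (2*m - s - 1) * varB * varA ^ s)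
      else if p < m then
        (\<Sum>i = p - 1..p. \<Sum>s = p..2*m - i - 1.
           varA ^ i * varB * varA ^ (2*m - s - i - 1) * varB * varA ^ s)
      else varA ^ (m - 1) * varB ^ 2 * varA ^ m)"

end

theory Submission
  imports Defs
begin

text \<open>
  Up to cyclic equivalence a word may be rotated freely, so both sides of the claim are linear
  combinations of necklaces with four letters \<open>B\<close>. Such a necklace is given by the four gaps
  between consecutive \<open>B\<close>s, that is, by a list of four exponents of \<open>A\<close> with sum \<open>2h\<close>, where
  \<open>h = 2m - 1\<close>, read up to rotation. The theorem amounts to an identity between the multiplicities
  with which each cyclic gap sequence occurs on the two sides.

  Everything is brought into this form by one averaging principle (\<open>rotation_average\<close>): if the sum
  of a weight over the rotations of each list is a constant, then a weighted sum over all
  lists is a constant multiple of the unweighted one. With the weight that detects an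
  initial \<open>B\<close>, whose rotations sum to the number of \<open>B\<close>s, it turns \<open>4 S\<close> into
  \<open>4m + 2\<close> times the sum of all gap words (\<open>S_cyclically_equivalent_gap_words\<close>).

  For the squares, each \<open>f_p\<close> is the sum of the words \<open>A^i B A^(h-s-i) B A^s\<close> with
  \<open>p - 1 \<le> i \<le> p \<le> s\<close> and \<open>s + i \<le> h\<close>; the cases \<open>p = 0\<close> and \<open>p = m\<close> obey the same rule,
  because there the bounds leave a single value of \<open>i\<close>. A term of \<open>f_p^* f_p\<close> rotates to the word
  with gaps \<open>b = h - s' - i'\<close>, \<open>c = i' + i\<close>, \<open>d = h - s - i\<close>, \<open>a = s + s'\<close>.
  Since \<open>i\<close> and \<open>i'\<close> differ by at most one, \<open>c\<close> leaves just two candidates for \<open>(p, i', i)\<close>,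
  and the constraints \<open>p \<le> s, s'\<close> become comparisons of \<open>b + c\<close> and \<open>c + d\<close> with \<open>h\<close>
  (\<open>card_product_gaps_fibre\<close>). Hence \<open>(b, c, d, a)\<close> receives weight 2 if both sums are below \<open>h\<close>,
  and weight 0 if one is above it; the parity of \<open>c\<close> matters only when both equal \<open>h\<close>.

  These weights sum to 2 over the four rotations (\<open>sum_fibre_size_rotations\<close>). Opposite pairs of
  neighbouring gaps sum to \<open>2h\<close>, so generically exactly one gap has both of its neighbouring sums
  below \<open>h\<close>. A second use of the averaging principle gives twice the sum of all gap words as
  four times the sum of squares, and the two results combine to the claim after division by 4.
\<close>

section \<open>Cyclic equivalence\<close>

lemma cyclically_equivalent_refl: "cyclically_equivalent f f"
  unfolding cyclically_equivalent_def by (rule exI[of _ 0]) simp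

lemma cyclically_equivalent_add:
  assumes "cyclically_equivalent f g" "cyclically_equivalent f' g'"
  shows "cyclically_equivalent (f + f') (g + g')"
proof -
  obtain n :: nat and a b where 1: "f - g = (\<Sum>k<n. commutator (a k) (b k))"
    using assms(1) unfolding cyclically_equivalent_def by blast
  obtain n' :: nat and a' b' where 2: "f' - g' = (\<Sum>k<n'. commutator (a' k) (b' k))"
    using assms(2) unfolding cyclically_equivalent_def by blast
  let ?a = "\<lambda>k. if k < n then a k else a' (k - n)"
  let ?b = "\<lambda>k. if k < n then b k else b' (k - n)"
  have "(\<Sum>k<n + n'. commutator (?a k) (?b k)) =
          (\<Sum>k<n. commutator (?a k) (?b k)) + (\<Sum>k<n'. commutator (?a (n + k)) (?b (n + k)))"
    by (induction n') (simp_all add: add.assoc)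
  also have "\<dots> = (f - g) + (f' - g')"
    by (simp add: 1 2)
  finally have "(f + f') - (g + g') = (\<Sum>k<n + n'. commutator (?a k) (?b k))"
    by (simp add: algebra_simps)
  then show ?thesis
    unfolding cyclically_equivalent_def by (intro exI)
qed

lemma cyclically_equivalent_sum:
  assumes "\<And>x. x \<in> X \<Longrightarrow> cyclically_equivalent (f x) (g x)"
  shows "cyclically_equivalent (\<Sum>x\<in>X. f x) (\<Sum>x\<in>X. g x)"
  using assms
  by (induction X rule: infinite_finite_induct)
    (simp_all add: cyclically_equivalent_refl cyclically_equivalent_add)

lemma single_zero_commute:
  "Poly_Mapping.single 0 c * f = f * Poly_Mapping.single 0 c" for f :: ncpoly
  by (induction f rule: ncpoly_induct) (simp_all add: mult_single algebra_simps)

lemma cyclically_equivalent_scale: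
  assumes "cyclically_equivalent f g"
  shows "cyclically_equivalent (Poly_Mapping.single 0 c * f) (Poly_Mapping.single 0 c * g)"
proof -
  let ?c = "Poly_Mapping.single 0 c :: ncpoly"
  obtain n :: nat and a b where 1: "f - g = (\<Sum>k<n. commutator (a k) (b k))"
    using assms unfolding cyclically_equivalent_def by blast
  have "?c * commutator x y = commutator (?c * x) y" for x y
    by (simp add: commutator_def algebra_simps)
      (metis mult.assoc single_zero_commute)
  then have "?c * f - ?c * g = (\<Sum>k<n. commutator (?c * a k) (b k))"
    by (simp add: 1 sum_distrib_left flip: right_diff_distrib)
  then show ?thesis
    unfolding cyclically_equivalent_def by (intro exI) assumption
qed

lemma cyclically_equivalent_of_nat_mult:
  assumes "cyclically_equivalent f g"
  shows "cyclically_equivalent (of_nat n * f) (of_nat n * g)"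
  using cyclically_equivalent_scale[OF assms, of "of_nat n"] by simp

text \<open>
  Averaging over rotations only yields multiples of the wanted equivalence; real coefficients
  make it possible to divide by the factor again.
\<close>

lemma cyclically_equivalent_of_nat_cancel:
  assumes "cyclically_equivalent (of_nat n * f) (of_nat n * g)" and "n > 0"
  shows "cyclically_equivalent f g"
proof -
  have "Poly_Mapping.single 0 (1 / real n) * (of_nat n * h) = h" for h :: ncpoly
    using \<open>n > 0\<close> by (simp add: mult_single flip: single_of_nat mult.assoc)
  then show ?thesis
    using cyclically_equivalent_scale[OF assms(1), of "1 / real n"] by simp
qed

lemma cyclically_equivalent_sym:
  assumes "cyclically_equivalent f g"
  shows "cyclically_equivalent g f"
  using cyclically_equivalent_add[OF cyclically_equivalent_scale[OF assms, of "-1"]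
      cyclically_equivalent_refl[of "f + g"]]
  by (simp add: single_uminus)

lemma cyclically_equivalent_trans [trans]:
  assumes "cyclically_equivalent f g" "cyclically_equivalent g h"
  shows "cyclically_equivalent f h"
  using cyclically_equivalent_add[OF assms]
  by (simp add: cyclically_equivalent_def)

text \<open>
  In a chain that mixes this relation with equality, these two rules prevent a search for
  a position at which the equation could be substituted.
\<close>

lemma cyclically_equivalent_eq_trans [trans]:
  "cyclically_equivalent f g \<Longrightarrow> g = h \<Longrightarrow> cyclically_equivalent f h"
  by simp

lemma eq_cyclically_equivalent_trans [trans]:
  "f = g \<Longrightarrow> cyclically_equivalent g h \<Longrightarrow> cyclically_equivalent f h"
  by simp

lemma cyclically_equivalent_mult_commute: "cyclically_equivalent (f * g) (g * f)"
  unfolding cyclically_equivalent_def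
  by (intro exI[of _ "1 :: nat"] exI[of _ "\<lambda>_. f"] exI[of _ "\<lambda>_. g"]) (simp add: commutator_def)

section \<open>Words and averaging over rotations\<close>

definition word_poly :: "letter list \<Rightarrow> ncpoly" where
  "word_poly w = prod_list (map var w)"

lemma word_poly_append: "word_poly (u @ v) = word_poly u * word_poly v"
  by (simp add: word_poly_def)

lemma word_poly_append_commute: "cyclically_equivalent (word_poly (u @ v)) (word_poly (v @ u))"
  by (simp add: word_poly_append cyclically_equivalent_mult_commute)

lemma star_word_poly: "star (word_poly w) = word_poly (rev w)"
  by (simp add: word_poly_def prod_list_var star_single rev_word_def)

lemma star_sum: "star (\<Sum>x\<in>X. f x) = (\<Sum>x\<in>X. star (f x))"
  by (induction X rule: infinite_finite_induct) (simp_all add: star_add)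

text \<open>
  Moving every term to each of its \<open>n\<close> rotations does not change it up to cyclic equivalence.
  After summation over all lists, each rotation merely permutes the set of lists, so each of the
  \<open>n\<close> rotations contributes the same weighted sum.
\<close>

lemma rotation_average:
  fixes X :: "'a list set" and P :: "'a list \<Rightarrow> ncpoly" and weight :: "'a list \<Rightarrow> nat"
  assumes fin: "finite X"
    and closed: "\<And>x. x \<in> X \<Longrightarrow> rotate1 x \<in> X"
    and invariant: "\<And>x. cyclically_equivalent (P x) (P (rotate1 x))"
    and orbit: "\<And>x. x \<in> X \<Longrightarrow> (\<Sum>j<n. weight (rotate j x)) = c"
  shows "cyclically_equivalent (of_nat c * (\<Sum>x\<in>X. P x))
           (of_nat n * (\<Sum>x\<in>X. of_nat (weight x) * P x))"
proof -
  have rotate_in: "rotate j x \<in> X" if "x \<in> X" for j x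
    using that by (induction j) (simp_all add: closed)
  have P_rotate: "cyclically_equivalent (P x) (P (rotate j x))" for j x
    by (induction j)
      (auto intro: cyclically_equivalent_refl cyclically_equivalent_trans invariant)
  have inj: "inj_on (rotate j) X" for j
  proof (rule inj_onI)
    fix x y :: "'a list" assume eq: "rotate j x = rotate j y"
    then have "length x = length y"
      by (metis length_rotate)
    with eq show "x = y"
      by (induction j) (auto dest: injD[OF inj_rotate1])
  qed
  have bij: "bij_betw (rotate j) X X" for j
    using rotate_in inj endo_inj_surj[OF fin _ inj] by (simp add: bij_betw_def image_subset_iff)
  have "of_nat c * (\<Sum>x\<in>X. P x) = (\<Sum>x\<in>X. \<Sum>j<n. of_nat (weight (rotate j x)) * P x)"
    by (simp add: sum_distrib_left orbit flip: sum_distrib_right of_nat_sum)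
  also have "cyclically_equivalent \<dots>
      (\<Sum>x\<in>X. \<Sum>j<n. of_nat (weight (rotate j x)) * P (rotate j x))"
    by (intro cyclically_equivalent_sum cyclically_equivalent_of_nat_mult P_rotate)
  also have "(\<Sum>x\<in>X. \<Sum>j<n. of_nat (weight (rotate j x)) * P (rotate j x)) =
      (\<Sum>j<n. \<Sum>x\<in>X. of_nat (weight (rotate j x)) * P (rotate j x))"
    by (rule sum.swap)
  also have "\<dots> = (\<Sum>j<n. \<Sum>x\<in>X. of_nat (weight x) * P x)"
    by (intro sum.cong refl sum.reindex_bij_betw[OF bij])
  also have "\<dots> = of_nat n * (\<Sum>x\<in>X. of_nat (weight x) * P x)"
    by simp
  finally show ?thesis .
qed

section \<open>Words as sequences of gaps\<close>

text \<open>
  Each gap is attached to the \<open>B\<close> before it, so that a rotation of the gaps is a rotation of the word.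
\<close>

definition gap_word :: "nat list \<Rightarrow> letter list" where
  "gap_word gs = concat (map (\<lambda>g. LB # replicate g LA) gs)"

lemma gap_word_simps [simp]:
  "gap_word [] = []"
  "gap_word (g # gs) = LB # replicate g LA @ gap_word gs"
  by (simp_all add: gap_word_def)

lemma gap_word_append: "gap_word (gs @ hs) = gap_word gs @ gap_word hs"
  by (simp add: gap_word_def)

lemma length_gap_word: "length (gap_word gs) = length gs + sum_list gs"
  by (induction gs) simp_all

lemma count_gap_word: "count_list (gap_word gs) LB = length gs"
proof -
  have "count_list (replicate g LA) LB = 0" for g
    by (induction g) simp_all
  then show ?thesis by (induction gs) simp_all
qed

text \<open>
  The leading block of \<open>A\<close>s is what remains when a first \<open>B\<close> is removed; with it the statement is
  strong enough for induction.
\<close>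

lemma replicate_append_gap_word_inject:
  "replicate i LA @ gap_word gs = replicate j LA @ gap_word hs \<longleftrightarrow> i = j \<and> gs = hs"
proof (induction gs arbitrary: i j hs)
  case Nil
  show ?case
  proof (induction i arbitrary: j)
    case 0
    show ?case by (cases j; cases hs) auto
  next
    case (Suc i)
    then show ?case by (cases j; cases hs) auto
  qed
next
  case (Cons g gs)
  show ?case
  proof (induction i arbitrary: j)
    case 0
    show ?case using Cons by (cases j; cases hs) auto
  next
    case (Suc i)
    then show ?case by (cases j; cases hs) auto
  qed
qed

lemma inj_gap_word: "inj gap_word"
  using replicate_append_gap_word_inject[of 0 _ 0] by (auto intro!: injI)

lemma ex_replicate_append_gap_word: "\<exists>i gs. w = replicate i LA @ gap_word gs"
proof (induction w)
  case Nil
  show ?case by (intro exI[of _ 0] exI[of _ "[]"]) simp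
next
  case (Cons l w)
  then obtain i gs where w: "w = replicate i LA @ gap_word gs" by blast
  show ?case
  proof (cases l)
    case LA
    then show ?thesis using w by (intro exI[of _ "Suc i"] exI[of _ gs]) simp
  next
    case LB
    then show ?thesis using w by (intro exI[of _ 0] exI[of _ "i # gs"]) simp
  qed
qed

definition gap_lists :: "nat \<Rightarrow> nat \<Rightarrow> nat list set" where
  "gap_lists k N = {gs. length gs = k \<and> sum_list gs = N}"

lemma finite_gap_lists: "finite (gap_lists k N)"
proof (rule finite_subset)
  show "gap_lists k N \<subseteq> {gs. set gs \<subseteq> {..N} \<and> length gs = k}"
    by (auto simp: gap_lists_def dest: member_le_sum_list)
qed (simp add: finite_lists_length_eq)

lemma gap_word_image:
  assumes "k > 0"
  shows "gap_word ` gap_lists k N =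
    {w. length w = k + N \<and> count_list w LB = k \<and> hd w = LB}"
proof (intro equalityI subsetI)
  fix w assume "w \<in> gap_word ` gap_lists k N"
  then obtain gs where gs: "w = gap_word gs" "length gs = k" "sum_list gs = N"
    by (auto simp: gap_lists_def)
  then show "w \<in> {w. length w = k + N \<and> count_list w LB = k \<and> hd w = LB}"
    using assms by (cases gs) (auto simp: length_gap_word count_gap_word[of "_ # _", simplified])
next
  fix w assume w: "w \<in> {w. length w = k + N \<and> count_list w LB = k \<and> hd w = LB}"
  obtain i gs where eq: "w = replicate i LA @ gap_word gs"
    using ex_replicate_append_gap_word by blast
  have "w \<noteq> []" using w assms by auto
  then have "i = 0" using w eq by (cases i) auto
  then have "w = gap_word gs" using eq by simp
  then show "w \<in> gap_word ` gap_lists k N"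
    using w by (auto simp: gap_lists_def length_gap_word count_gap_word)
qed

lemma sum_rotations_hd_eq_count_list:
  "(\<Sum>j<length w. of_bool (hd (rotate j w) = l)) = count_list w l"
proof -
  have "(\<Sum>j<length w. of_bool (hd (rotate j w) = l)) = (\<Sum>j<length w. of_bool (w ! j = l) :: nat)"
  proof (intro sum.cong refl)
    fix j assume "j \<in> {..<length w}"
    then have "w \<noteq> []" "j mod length w = j" by auto
    then show "(of_bool (hd (rotate j w) = l) :: nat) = of_bool (w ! j = l)"
      by (simp add: hd_rotate_conv_nth)
  qed
  also have "\<dots> = card {j. j < length w \<and> w ! j = l}"
    by (simp add: of_bool_def sum.If_cases lessThan_def Int_def)
  also have "\<dots> = count_list w l"
    by (simp add: count_list_eq_length_filter length_filter_conv_card eq_commute)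
  finally show ?thesis .
qed

lemma count_list_rotate1: "count_list (rotate1 w) l = count_list w l"
  by (cases w) simp_all

lemma word_poly_rotate1: "cyclically_equivalent (word_poly w) (word_poly (rotate1 w))"
  by (cases w)
    (use word_poly_append_commute[of "[_]"] in \<open>simp_all add: cyclically_equivalent_refl\<close>)

text \<open>
  Each word has \<open>k\<close> rotations that start with \<open>B\<close>, counted with multiplicity, so that averaging
  concentrates \<open>S\<close> on the words that start with \<open>B\<close>.
\<close>

lemma S_cyclically_equivalent_gap_words:
  assumes "k > 0"
  shows "cyclically_equivalent (of_nat k * S (k + N) k)
    (of_nat (k + N) * (\<Sum>gs\<in>gap_lists k N. word_poly (gap_word gs)))"
proof -
  let ?X = "{w. length w = k + N \<and> count_list w LB = k}"
  have "cyclically_equivalent (of_nat k * S (k + N) k)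
    (of_nat (k + N) * (\<Sum>w\<in>?X. of_nat (of_bool (hd w = LB)) * word_poly w))"
    unfolding S_def word_poly_def[symmetric]
  proof (rule rotation_average)
    show "(\<Sum>j<k + N. of_bool (hd (rotate j w) = LB)) = k" if "w \<in> ?X" for w
      using that sum_rotations_hd_eq_count_list[of w LB] by simp
  qed (auto simp: finite_words count_list_rotate1 word_poly_rotate1)
  also have "(\<Sum>w\<in>?X. of_nat (of_bool (hd w = LB)) * word_poly w) =
      (\<Sum>w\<in>gap_word ` gap_lists k N. word_poly w)"
    unfolding gap_word_image[OF assms]
    by (intro sum.mono_neutral_cong_right) (auto simp: finite_words)
  also have "\<dots> = (\<Sum>gs\<in>gap_lists k N. word_poly (gap_word gs))"
    by (simp add: sum.reindex inj_on_subset[OF inj_gap_word])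
  finally show ?thesis .
qed

lemma word_poly_gap_word_rotate1:
  "cyclically_equivalent (word_poly (gap_word gs)) (word_poly (gap_word (rotate1 gs)))"
proof (cases gs)
  case (Cons g hs)
  then show ?thesis
    using word_poly_append_commute[of "gap_word [g]" "gap_word hs"]
    by (simp add: gap_word_append)
qed (simp add: cyclically_equivalent_refl)

section \<open>The sum of squares\<close>

text \<open>
  In the following, \<open>h\<close> stands for \<open>2m - 1\<close>, the number of letters \<open>A\<close> in every word of \<open>f_p\<close>. The
  condition \<open>p \<le> i + 1\<close> expresses \<open>p - 1 \<le> i\<close> without truncated subtraction.
\<close>

definition f_indices :: "nat \<Rightarrow> nat \<Rightarrow> (nat \<times> nat) set" where
  "f_indices h p = {(i, s). i \<le> p \<and> p \<le> i + 1 \<and> p \<le> s \<and> s + i \<le> h}"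

definition two_B_word :: "nat \<Rightarrow> nat \<times> nat \<Rightarrow> letter list" where
  "two_B_word h = (\<lambda>(i, s).
     replicate i LA @ [LB] @ replicate (h - s - i) LA @ [LB] @ replicate s LA)"

lemma finite_f_indices: "finite (f_indices h p)"
  by (rule finite_subset[of _ "{..h} \<times> {..h}"]) (auto simp: f_indices_def)

lemma word_poly_two_B_word:
  "word_poly (two_B_word h (i, s)) =
     varA ^ i * varB * varA ^ (h - s - i) * varB * varA ^ s"
  by (simp add: two_B_word_def word_poly_def prod_list_replicate mult.assoc)

text \<open>
  One index set serves all three branches: \<open>p = 0\<close> forces \<open>i = 0\<close>, and for \<open>p = m\<close> the bounds
  \<open>m \<le> s\<close> and \<open>s + i \<le> 2m - 1\<close> leave only \<open>i = m - 1\<close> and \<open>s = m\<close>.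
\<close>

lemma f_poly_eq:
  assumes "m \<ge> 1" "p \<le> m"
  shows "f_poly m p = (\<Sum>x\<in>f_indices (2*m - 1) p. word_poly (two_B_word (2*m - 1) x))"
proof -
  consider "p = 0" | "0 < p" "p < m" | "0 < p" "p = m" using assms by linarith
  then show ?thesis
  proof cases
    case 1
    have "f_indices (2*m - 1) 0 = Pair 0 ` {0..2*m - 1}"
      by (auto simp: f_indices_def)
    then show ?thesis
      using 1 by (simp add: f_poly_def word_poly_two_B_word sum.reindex inj_on_def)
  next
    case 2
    have "f_indices (2*m - 1) p = Sigma {p - 1..p} (\<lambda>i. {p..2*m - i - 1})"
      using 2 by (auto simp: f_indices_def)
    then show ?thesis
      using 2 by (simp add: f_poly_def sum.Sigma word_poly_two_B_word case_prod_unfold)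
        (intro sum.cong refl, auto simp: word_poly_two_B_word diff_commute)
  next
    case 3
    have "f_indices (2*m - 1) p = {(m - 1, m)}"
      using 3 by (auto simp: f_indices_def)
    then show ?thesis
      using 3 by (simp add: f_poly_def word_poly_two_B_word power2_eq_square mult.assoc)
  qed
qed

text \<open>
  The starred factor comes first, so its indices \<open>i'\<close>, \<open>s'\<close> stand before \<open>i\<close>, \<open>s\<close>. The component \<open>p\<close>
  keeps apart equal pairs of words that come from different squares.
\<close>

fun product_gaps :: "nat \<Rightarrow> nat \<times> (nat \<times> nat) \<times> (nat \<times> nat) \<Rightarrow> nat list" where
  "product_gaps h (p, (i', s'), (i, s)) = [h - s' - i', i' + i, h - s - i, s + s']"

text \<open>
  The initial block \<open>A^s'\<close> of the product is rotated to the end, where it merges with \<open>A^s\<close>; in the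
  middle \<open>A^i'\<close> meets \<open>A^i\<close>.
\<close>

lemma star_two_B_word_mult:
  "cyclically_equivalent
     (star (word_poly (two_B_word h x)) * word_poly (two_B_word h y))
     (word_poly (gap_word (product_gaps h (p, x, y))))"
proof -
  obtain i' s' i s where xy: "x = (i', s')" "y = (i, s)" by (cases x; cases y) blast
  let ?v = "LB # replicate (h - s' - i') LA @ LB # replicate (i' + i) LA @
    LB # replicate (h - s - i) LA @ LB # replicate s LA"
  have "star (word_poly (two_B_word h x)) * word_poly (two_B_word h y) =
      word_poly (replicate s' LA @ ?v)"
    by (simp add: xy star_word_poly two_B_word_def replicate_add flip: word_poly_append)
  moreover have "gap_word (product_gaps h (p, x, y)) = ?v @ replicate s' LA"
    by (simp add: xy replicate_add)
  ultimately show ?thesis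
    by (metis word_poly_append_commute)
qed

definition square_indices :: "nat \<Rightarrow> nat \<Rightarrow> (nat \<times> (nat \<times> nat) \<times> (nat \<times> nat)) set" where
  "square_indices h m = Sigma {0..m} (\<lambda>p. f_indices h p \<times> f_indices h p)"

lemma sum_of_squares_cyclically_equivalent:
  assumes "m \<ge> 1"
  shows "cyclically_equivalent (\<Sum>p = 0..m. star (f_poly m p) * f_poly m p)
    (\<Sum>t\<in>square_indices (2*m - 1) m. word_poly (gap_word (product_gaps (2*m - 1) t)))"
proof -
  let ?h = "2*m - 1"
  have "(\<Sum>p = 0..m. star (f_poly m p) * f_poly m p) =
      (\<Sum>p = 0..m. \<Sum>x\<in>f_indices ?h p. \<Sum>y\<in>f_indices ?h p.
         star (word_poly (two_B_word ?h x)) * word_poly (two_B_word ?h y))"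
    using assms by (intro sum.cong refl) (simp add: f_poly_eq star_sum sum_product)
  also have "cyclically_equivalent \<dots>
      (\<Sum>p = 0..m. \<Sum>x\<in>f_indices ?h p. \<Sum>y\<in>f_indices ?h p.
         word_poly (gap_word (product_gaps ?h (p, x, y))))"
    by (intro cyclically_equivalent_sum star_two_B_word_mult)
  also have "(\<Sum>p = 0..m. \<Sum>x\<in>f_indices ?h p. \<Sum>y\<in>f_indices ?h p.
         word_poly (gap_word (product_gaps ?h (p, x, y)))) =
      (\<Sum>p = 0..m. \<Sum>z\<in>f_indices ?h p \<times> f_indices ?h p.
         word_poly (gap_word (product_gaps ?h (p, z))))"
    by (simp only: sum.cartesian_product case_prod_unfold prod.collapse)
  also have "\<dots> = (\<Sum>t\<in>square_indices ?h m. word_poly (gap_word (product_gaps ?h t)))"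
    unfolding square_indices_def
    by (subst sum.Sigma)
      (simp_all add: finite_f_indices case_prod_unfold del: product_gaps.simps)
  finally show ?thesis .
qed

text \<open>
  The number of terms in the sum of squares whose gaps are \<open>gs\<close>, in closed form. For \<open>c = 2q\<close> the
  two summands belong to \<open>p = q\<close> and \<open>p = q + 1\<close> with \<open>i' = i = q\<close>; for \<open>c = 2q + 1\<close> they
  belong to \<open>p = q + 1\<close> with \<open>(i', i)\<close> equal to \<open>(q + 1, q)\<close> and \<open>(q, q + 1)\<close>.
\<close>

definition fibre_size :: "nat \<Rightarrow> nat list \<Rightarrow> nat" where
  "fibre_size h gs = (let b = gs ! 0; c = gs ! 1; d = gs ! 2 in
     if even c then of_bool (b + c \<le> h \<and> c + d \<le> h) + of_bool (b + c < h \<and> c + d < h)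
     else of_bool (b + c < h \<and> c + d \<le> h) + of_bool (b + c \<le> h \<and> c + d < h))"

lemma product_gaps_in_gap_lists:
  assumes "x \<in> f_indices h p" "y \<in> f_indices h p"
  shows "product_gaps h (p, x, y) \<in> gap_lists 4 (2 * h)"
proof -
  obtain i' s' i s where xy: "x = (i', s')" "y = (i, s)" by (cases x; cases y) blast
  have "s' + i' \<le> h" "s + i \<le> h" using assms by (auto simp: xy f_indices_def)
  then have "(h - s' - i') + (i' + i) + (h - s - i) + (s + s') = 2 * h" by linarith
  then show ?thesis by (simp add: xy gap_lists_def)
qed

text \<open>
  Once \<open>p\<close>, \<open>i'\<close> and \<open>i\<close> are chosen with \<open>i' + i = c\<close>, the gaps \<open>b\<close> and \<open>d\<close> determine \<open>s'\<close> and \<open>s\<close>, and the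
  fourth gap then agrees because the gaps sum to \<open>2h\<close>. So a fibre consists of at most one
  element for each admissible \<open>(p, i', i)\<close>, subject to \<open>p \<le> s'\<close> and \<open>p \<le> s\<close>.
\<close>

lemma card_product_gaps_fibre:
  assumes h: "h + 1 = 2 * m" and gs: "gs \<in> gap_lists 4 (2 * h)"
  shows "card {t \<in> square_indices h m. product_gaps h t = gs} = fibre_size h gs"
proof -
  obtain b c d a where gs_eq: "gs = [b, c, d, a]"
    using gs by (auto simp: gap_lists_def length_Suc_conv eval_nat_numeral)
  have total: "a + b + c + d = 2 * h"
    using gs gs_eq by (auto simp: gap_lists_def)
  define t where "t p i' i = (p, (i', h - b - i'), (i, h - d - i))" for p i' i :: nat
  \<comment> \<open>The two bounds say \<open>p \<le> s'\<close> and \<open>p \<le> s\<close>, and in addition that the subtractions in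
    the chosen index do not truncate.\<close>
  define F where "F p i' i = (if b + p + i' \<le> h \<and> d + p + i \<le> h then {t p i' i} else {})"
    for p i' i :: nat
  have fibre: "{t \<in> square_indices h m. product_gaps h t = gs} =
      {x. \<exists>p i' i. x \<in> F p i' i \<and>
         (i' + i = c \<and> i' \<le> p \<and> p \<le> i' + 1 \<and> i \<le> p \<and> p \<le> i + 1)}"
    (is "?L = ?R")
  proof (intro equalityI subsetI)
    fix x assume "x \<in> ?L"
    moreover obtain p i' s' i s where x: "x = (p, (i', s'), (i, s))"
      by (metis prod.exhaust)
    ultimately have idx: "i' \<le> p" "p \<le> i' + 1" "p \<le> s'" "s' + i' \<le> h"
        "i \<le> p" "p \<le> i + 1" "p \<le> s" "s + i \<le> h"
      and gaps: "b = h - s' - i'" "c = i' + i" "d = h - s - i"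
      by (auto simp: gs_eq square_indices_def f_indices_def)
    have "s' = h - b - i'" "s = h - d - i" "b + p + i' \<le> h" "d + p + i \<le> h"
      using idx gaps by linarith+
    then have "x \<in> F p i' i"
      by (simp add: F_def t_def x)
    then show "x \<in> ?R" using idx gaps by blast
  next
    fix x assume "x \<in> ?R"
    then obtain p i' i where x: "x = t p i' i" and bounds: "b + p + i' \<le> h" "d + p + i \<le> h"
      and i: "i' + i = c" "i' \<le> p" "p \<le> i' + 1" "i \<le> p" "p \<le> i + 1"
      by (auto simp: F_def split: if_splits)
    define s' s where "s' = h - b - i'" and "s = h - d - i"
    have ss: "s' + b + i' = h" "s + d + i = h"
      using bounds by (simp_all add: s'_def s_def)
    \<comment> \<open>The range \<open>p \<le> m\<close> is automatic: \<open>2p - 1 \<le> p + i \<le> h = 2m - 1\<close>.\<close>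
    have "p \<le> m" using h i bounds by linarith
    moreover have "p \<le> s'" "p \<le> s" using ss bounds by linarith+
    moreover have "h - s' - i' = b" "h - s - i = d" "s + s' = a"
      using ss total i by linarith+
    moreover have "x = (p, (i', s'), (i, s))"
      by (simp add: x t_def s'_def s_def)
    moreover have "s' + i' \<le> h" "s + i \<le> h" using ss by linarith+
    ultimately show "x \<in> ?L"
      using i by (simp add: gs_eq square_indices_def f_indices_def)
  qed
  define q where "q = c div 2"
  show ?thesis
  proof (cases "even c")
    case True
    then have c: "c = 2 * q" by (simp add: q_def)
    have pairs: "(i' + i = c \<and> i' \<le> p \<and> p \<le> i' + 1 \<and> i \<le> p \<and> p \<le> i + 1) \<longleftrightarrow>
        i' = q \<and> i = q \<and> (p = q \<or> p = q + 1)" for p i' i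
      unfolding c by (cases i' q rule: linorder_cases) auto
    have "{t \<in> square_indices h m. product_gaps h t = gs} = F q q q \<union> F (q + 1) q q"
      unfolding fibre pairs by blast
    also have "card \<dots> = card (F q q q) + card (F (q + 1) q q)"
      by (intro card_Un_disjoint) (auto simp: F_def t_def)
    also have "\<dots> = fibre_size h gs"
      using True by (auto simp: F_def fibre_size_def gs_eq c)
    finally show ?thesis .
  next
    case False
    then have c: "c = 2 * q + 1" by (simp add: q_def)
    have pairs: "(i' + i = c \<and> i' \<le> p \<and> p \<le> i' + 1 \<and> i \<le> p \<and> p \<le> i + 1) \<longleftrightarrow>
        p = q + 1 \<and> (i' = q + 1 \<and> i = q \<or> i' = q \<and> i = q + 1)" for p i' i
      unfolding c by (cases i' q rule: linorder_cases) auto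
    have "{t \<in> square_indices h m. product_gaps h t = gs} =
        F (q + 1) (q + 1) q \<union> F (q + 1) q (q + 1)"
      unfolding fibre pairs by blast
    also have "card \<dots> = card (F (q + 1) (q + 1) q) + card (F (q + 1) q (q + 1))"
      by (intro card_Un_disjoint) (auto simp: F_def t_def)
    also have "\<dots> = fibre_size h gs"
      using False by (auto simp: F_def fibre_size_def gs_eq c)
    finally show ?thesis .
  qed
qed

text \<open>
  Of \<open>a + b\<close> and \<open>c + d\<close> one is below \<open>h\<close> and the other above, unless both equal \<open>h\<close>; likewise for
  \<open>b + c\<close> and \<open>d + a\<close>. If no sum equals \<open>h\<close>, the gap common to the two small sums has weight 2. If
  just one opposite pair equals \<open>h\<close>, the two gaps in the remaining small sum have weight 1 each. If all
  sums equal \<open>h\<close>, then \<open>a = c\<close> and \<open>b = d\<close>, and as \<open>h\<close> is odd exactly one of these opposite pairs is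
  even and has weight 1 at each of its two gaps.
\<close>

lemma sum_fibre_size_rotations:
  assumes "odd h" and gs: "gs \<in> gap_lists 4 (2 * h)"
  shows "(\<Sum>j<4. fibre_size h (rotate j gs)) = 2"
proof -
  obtain b c d a where gs_eq: "gs = [b, c, d, a]"
    using gs by (auto simp: gap_lists_def length_Suc_conv eval_nat_numeral)
  have total: "a + b + c + d = 2 * h"
    using gs gs_eq by (simp add: gap_lists_def)
  have sums: "a + b < h \<longleftrightarrow> h < c + d" "a + b \<le> h \<longleftrightarrow> h \<le> c + d"
    "d + a < h \<longleftrightarrow> h < b + c" "d + a \<le> h \<longleftrightarrow> h \<le> b + c"
    using total by linarith+
  have "(\<Sum>j<4. fibre_size h (rotate j gs)) =
      fibre_size h [b, c, d, a] + fibre_size h [c, d, a, b] +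
      fibre_size h [d, a, b, c] + fibre_size h [a, b, c, d]"
  proof -
    have "{..<4} = {0, 1, 2, 3 :: nat}" by auto
    then show ?thesis by (simp add: gs_eq rotate_drop_take)
  qed
  also have "\<dots> = 2"
  proof (cases "b + c = h \<and> c + d = h")
    case True
    then have "d = b" "a = c" "even b \<longleftrightarrow> odd c"
      using total \<open>odd h\<close> by auto
    then show ?thesis using True by (auto simp: fibre_size_def add.commute)
  next
    case False
    then show ?thesis
      using sums by (cases "b + c" h rule: linorder_cases; cases "c + d" h rule: linorder_cases)
        (auto simp: fibre_size_def)
  qed
  finally show ?thesis .
qed

theorem proposition3p3:
  fixes m :: nat
  assumes "m \<ge> 1"
  shows "cyclically_equivalent (S (4*m + 2) 4)
           (of_nat (2*m + 1) * (\<Sum>p = 0..m. star (f_poly m p) * f_poly m p))"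
proof -
  let ?h = "2*m - 1"
  let ?W = "\<lambda>gs. word_poly (gap_word gs)"
  let ?G = "gap_lists 4 (2 * ?h)"
  let ?Q = "\<Sum>p = 0..m. star (f_poly m p) * f_poly m p"
  \<comment> \<open>Sorting the terms of the squares by their gaps turns multiplicities into weights.\<close>
  have "product_gaps ?h t \<in> ?G" if "t \<in> square_indices ?h m" for t
    using that
    by (auto simp: square_indices_def simp del: product_gaps.simps
        intro: product_gaps_in_gap_lists)
  then have "(\<Sum>t\<in>square_indices ?h m. ?W (product_gaps ?h t)) =
      (\<Sum>gs\<in>?G. \<Sum>t | t \<in> square_indices ?h m \<and> product_gaps ?h t = gs. ?W (product_gaps ?h t))"
    by (intro sum.group[symmetric] finite_gap_lists)
      (auto simp: square_indices_def finite_f_indices)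
  also have "\<dots> = (\<Sum>gs\<in>?G. of_nat (fibre_size ?h gs) * ?W gs)"
  proof (intro sum.cong refl)
    fix gs assume "gs \<in> ?G"
    then have "card {t \<in> square_indices ?h m. product_gaps ?h t = gs} = fibre_size ?h gs"
      using assms by (intro card_product_gaps_fibre) auto
    then show "(\<Sum>t | t \<in> square_indices ?h m \<and> product_gaps ?h t = gs. ?W (product_gaps ?h t)) =
        of_nat (fibre_size ?h gs) * ?W gs"
      by simp
  qed
  finally have Q: "cyclically_equivalent ?Q (\<Sum>gs\<in>?G. of_nat (fibre_size ?h gs) * ?W gs)"
    using sum_of_squares_cyclically_equivalent[OF assms] by simp
  have weights: "cyclically_equivalent (of_nat 2 * (\<Sum>gs\<in>?G. ?W gs))
      (of_nat 4 * (\<Sum>gs\<in>?G. of_nat (fibre_size ?h gs) * ?W gs))"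
  proof (rule rotation_average)
    show "rotate1 gs \<in> ?G" if "gs \<in> ?G" for gs
      using that by (cases gs) (auto simp: gap_lists_def)
    show "(\<Sum>j<4. fibre_size ?h (rotate j gs)) = 2" if "gs \<in> ?G" for gs
      using that assms by (intro sum_fibre_size_rotations) auto
  qed (auto simp: finite_gap_lists word_poly_gap_word_rotate1)
  have length_eq: "4 + 2 * ?h = 4*m + 2" using assms by simp
  have "cyclically_equivalent (of_nat 4 * S (4*m + 2) 4)
      (of_nat (4*m + 2) * (\<Sum>gs\<in>?G. ?W gs))"
    using S_cyclically_equivalent_gap_words[of 4 "2 * ?h"] unfolding length_eq by simp
  also have "of_nat (4*m + 2) * (\<Sum>gs\<in>?G. ?W gs) =
      of_nat (2*m + 1) * (of_nat 2 * (\<Sum>gs\<in>?G. ?W gs))"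
  proof -
    have "4*m + 2 = (2*m + 1) * 2" by simp
    then show ?thesis by (simp only: of_nat_mult mult.assoc)
  qed
  also have "cyclically_equivalent \<dots> (of_nat (2*m + 1) *
      (of_nat 4 * (\<Sum>gs\<in>?G. of_nat (fibre_size ?h gs) * ?W gs)))"
    by (intro cyclically_equivalent_of_nat_mult weights)
  also have "cyclically_equivalent \<dots> (of_nat (2*m + 1) * (of_nat 4 * ?Q))"
    by (intro cyclically_equivalent_of_nat_mult cyclically_equivalent_sym[OF Q])
  also have "of_nat (2*m + 1) * (of_nat 4 * ?Q) = of_nat 4 * (of_nat (2*m + 1) * ?Q)"
    by (simp only: mult.commute[of "2*m + 1" 4] flip: mult.assoc of_nat_mult)
  finally show ?thesis
    by (rule cyclically_equivalent_of_nat_cancel) simp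
qed

end
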